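(* Let $n\ge3$, let $Q\subset\mathbb{R}^n$ be the unit Euclidean ball, and let $\xi$ be a random vector uniformly distributed over $Q$. Let $c_1,c_2\in\mathbb{R}^n$ satisfy $\|c_1\|=\|c_2\|=1$ and $c_1^\top c_2=0$, and consider the linear mapping $g:\mathbb{R}^n\to\mathbb{R}^2$, $g(x)=(c_1^\top x,\;c_2^\top x)^\top$. Let $p\in(0,1)$ and $\delta\in(0,1)$. Then the minimal sample size $N_{\min}$ that guarantees, with probability at least $p$, that at least one sample is mapped by $g$ at least $\delta$-close to the boundary of the image set $g(Q)$ is $$ N_{\min}=\left\lceil\frac{\ln(1-p)}{\ln\bigl(1-(2\delta-\delta^2)^{n/2}\bigr)}\right\rceil . $$ Moreover, for small $\delta$, $$ N_{\min}\approx-\frac{\ln(1-p)}{(2\delta-\delta^2)^{n/2}}, $$ in the sense that, for fixed $n$ and $p$, the ratio of the two sides tends to $1$ as $\delta\to0^+$.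
   Context: $\|\cdot\|$ is the Euclidean norm. For a positive integer $N$, the samples $\xi^{(1)},\dots,\xi^{(N)}$ are independent copies of $\xi$. The image $g(Q)$ is the closed unit disk in $\mathbb{R}^2$ centered at the origin; a sample $\xi^{(i)}$ is mapped at least $\delta$-close to the boundary if the Euclidean distance from $g(\xi^{(i)})$ to the unit circle is at most $\delta$, i.e. $\|g(\xi^{(i)})\|\ge1-\delta$. $N_{\min}$ is the smallest positive integer $N$ for which, with probability at least $p$, at least one of $\xi^{(1)},\dots,\xi^{(N)}$ is mapped at least $\delta$-close to the boundary. *)

theory Defs
  imports "HOL-Probability.Probability"
begin

definition planar_map :: "real ^ 'n \<Rightarrow> real ^ 'n \<Rightarrow> real ^ 'n \<Rightarrow> real ^ 2" where
  "planar_map c1 c2 x = vector [c1 \<bullet> x, c2 \<bullet> x]"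

text \<open>The law of a function is meaningful only if the function is measurable, and
  equality of the laws does not enforce this.\<close>

definition uniformly_distributed_over ::
  "'w measure \<Rightarrow> ('w \<Rightarrow> 'a::euclidean_space) \<Rightarrow> 'a set \<Rightarrow> bool" where
  "uniformly_distributed_over M \<xi> Q \<longleftrightarrow>
     \<xi> \<in> borel_measurable M \<and> distr M borel \<xi> = uniform_measure lborel Q"

text \<open>The samples are indexed from 1; the value at index 0 plays no role.\<close>

definition independent_copies ::
  "'w measure \<Rightarrow> ('w \<Rightarrow> 'a::euclidean_space) \<Rightarrow> (nat \<Rightarrow> 'w \<Rightarrow> 'a) \<Rightarrow> bool" where
  "independent_copies M \<xi> X \<longleftrightarrow>
     (\<forall>N\<ge>1. prob_space.indep_vars M (\<lambda>_. borel) X {1..N}) \<and>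
     (\<forall>i\<ge>1. distr M borel (X i) = distr M borel \<xi>)"

definition mapped_close_to_boundary ::
  "('a \<Rightarrow> 'b::metric_space) \<Rightarrow> 'a set \<Rightarrow> real \<Rightarrow> 'a \<Rightarrow> bool" where
  "mapped_close_to_boundary g Q \<delta> x \<longleftrightarrow> infdist (g x) (frontier (g ` Q)) \<le> \<delta>"

definition sufficient_sample_size ::
  "'w measure \<Rightarrow> (nat \<Rightarrow> 'w \<Rightarrow> 'a) \<Rightarrow> ('a \<Rightarrow> 'b::metric_space) \<Rightarrow> 'a set
     \<Rightarrow> real \<Rightarrow> real \<Rightarrow> nat \<Rightarrow> bool" where
  "sufficient_sample_size M X g Q p \<delta> N \<longleftrightarrow>
     N \<ge> 1 \<and>
     measure M {\<omega> \<in> space M. \<exists>i\<in>{1..N}. mapped_close_to_boundary g Q \<delta> (X i \<omega>)} \<ge> p"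

definition N_min ::
  "'w measure \<Rightarrow> (nat \<Rightarrow> 'w \<Rightarrow> 'a) \<Rightarrow> ('a \<Rightarrow> 'b::metric_space) \<Rightarrow> 'a set
     \<Rightarrow> real \<Rightarrow> real \<Rightarrow> nat" where
  "N_min M X g Q p \<delta> = (LEAST N. sufficient_sample_size M X g Q p \<delta> N)"

end

theory Submission
  imports Defs "HOL-Real_Asymp.Real_Asymp"
begin

text \<open>A sample is mapped \<open>\<delta>\<close>-close to the unit circle with probability
  \<open>(1 - s)\<close> to the power \<open>n / 2\<close>, where \<open>s = (1 - \<delta>)\<^sup>2\<close>. After a rotation, \<open>g\<close> is the projection
  to two coordinates \<open>y\<close>; call the others \<open>z\<close>. The part of the unit ball with
  \<open>\<bar>y\<bar>\<^sup>2 > s\<close> has as its slice at \<open>z\<close> an annulus of area \<open>\<pi> (1 - s - \<bar>z\<bar>\<^sup>2)\<close>. This is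
  also the area of the slice of the ball of radius \<open>sqrt (1 - s)\<close>, so the two volumes agree.
  Independence turns the single probability \<open>a\<close> into the condition \<open>1 - (1 - a) ^ N \<ge> p\<close>,
  which is solved for \<open>N\<close> by taking logarithms.\<close>

section \<open>Reflections, and moving one orthonormal pair to another\<close>

text \<open>The Householder reflection in the hyperplane orthogonal to \<open>v\<close>. For
  \<open>v = 0\<close> the formula gives the identity, so it is orthogonal for every
  \<open>v\<close>.\<close>

definition reflection :: "'a::real_inner \<Rightarrow> 'a \<Rightarrow> 'a" where
  "reflection v x = x - (2 * (v \<bullet> x) / (v \<bullet> v)) *\<^sub>R v"

lemma orthogonal_transformation_reflection: "orthogonal_transformation (reflection v)"
proof -
  have "linear (reflection v)"
    by (rule linearI)
      (simp_all add: reflection_def inner_add_right algebra_simps add_divide_distrib)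
  moreover have "reflection v x \<bullet> reflection v y = x \<bullet> y" for x y
  proof (cases "v = 0")
    case False
    \<comment> \<open>Naming the quotients writes \<open>v \<bullet> x\<close> and
      \<open>v \<bullet> y\<close> as multiples of \<open>v \<bullet> v\<close>; what remains is a
      polynomial identity without division.\<close>
    define a where "a = (v \<bullet> x) / (v \<bullet> v)"
    define b where "b = (v \<bullet> y) / (v \<bullet> v)"
    have "v \<bullet> x = a * (v \<bullet> v)" "v \<bullet> y = b * (v \<bullet> v)"
      using False by (simp_all add: a_def b_def)
    moreover from this have "x \<bullet> v = a * (v \<bullet> v)"
      by (simp add: inner_commute)
    ultimately have "(x - (2 * a) *\<^sub>R v) \<bullet> (y - (2 * b) *\<^sub>R v) = x \<bullet> y"
      by (simp add: inner_diff_left inner_diff_right algebra_simps)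
    then show ?thesis
      by (simp add: reflection_def a_def b_def)
  qed (simp add: reflection_def)
  ultimately show ?thesis
    by (simp add: orthogonal_transformation_def)
qed

text \<open>Vectors of equal norm are mirror images in the hyperplane orthogonal to their
  difference: the coefficient of \<open>a - b\<close> in the reflection of \<open>a\<close> is then
  exactly 1.\<close>

lemma reflection_diff:
  assumes "norm a = norm b"
  shows "reflection (a - b) a = b"
proof (cases "a = b")
  case False
  have "2 * ((a - b) \<bullet> a) = (a - b) \<bullet> (a - b)"
    using assms by (simp add: inner_diff_left inner_diff_right inner_commute norm_eq)
  then show ?thesis
    using False by (simp add: reflection_def)
qed (simp add: reflection_def)

lemma reflection_orthogonal: "v \<bullet> x = 0 \<Longrightarrow> reflection v x = x"
  by (simp add: reflection_def)

text \<open>Two reflections suffice. The first takes \<open>a\<close> to \<open>c\<close>; the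
  second takes the image of \<open>b\<close> to \<open>d\<close> and leaves \<open>c\<close> in
  place, because \<open>c\<close> is orthogonal to both of these vectors.\<close>

lemma orthogonal_transformation_exists_pair:
  fixes a b c d :: "'a::euclidean_space"
  assumes "norm a = norm c" "norm b = norm d" "a \<bullet> b = 0" "c \<bullet> d = 0"
  obtains f where "orthogonal_transformation f" "f a = c" "f b = d"
proof -
  define f where "f = reflection (a - c)"
  have f: "orthogonal_transformation f" "f a = c"
    using assms by (simp_all add: f_def orthogonal_transformation_reflection reflection_diff)
  have "norm (f b) = norm d" "c \<bullet> f b = 0"
    using assms f by (auto simp: orthogonal_transformation_norm orthogonal_transformation_def)
  then have "reflection (f b - d) (f b) = d" "reflection (f b - d) c = c"
    using assms by (auto intro!: reflection_diff reflection_orthogonal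
        simp: inner_diff_left inner_diff_right inner_commute[of d c] inner_commute[of "f b" c])
  then show thesis
    using that[of "reflection (f b - d) \<circ> f"] f
    by (simp add: orthogonal_transformation_compose orthogonal_transformation_reflection)
qed

section \<open>Volume of a ball outside a coordinate cylinder, by slicing\<close>

lemma emeasure_PiM_disk:
  fixes t :: real
  assumes "card J = 2"
  shows "emeasure (Pi\<^sub>M J (\<lambda>_. lborel)) {f \<in> space (Pi\<^sub>M J (\<lambda>_. lborel)). (\<Sum>j\<in>J. (f j)\<^sup>2) \<le> t}
         = ennreal (pi * max 0 t)"
    (is "emeasure ?M (?D t) = _")
proof -
  have J: "finite J"
    using assms by (auto intro: card_ge_0_finite)
  have pos: "emeasure ?M (?D t) = ennreal (pi * t)" if "t > 0" for t
  proof -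
    have "?D t = {f. sqrt (\<Sum>j\<in>J. (f j)\<^sup>2) \<le> sqrt t} \<inter> space ?M"
      by auto
    then show ?thesis
      using emeasure_cball_aux[OF J, of "sqrt t"] that assms
      by (simp add: unit_ball_vol_2)
  qed
  show ?thesis
  proof (cases "t > 0")
    case False
    have meas: "?D u \<in> sets ?M" for u
      by measurable
    \<comment> \<open>For \<open>t \<le> 0\<close> the disk lies in every disk of positive squared
      radius \<open>u\<close>, so its area is below every positive bound.\<close>
    have *: "emeasure ?M (?D t) \<le> ennreal (pi * u)" if "u > 0" for u
      using that False by (subst pos[OF that, symmetric], intro emeasure_mono meas) auto
    have "emeasure ?M (?D t) \<le> ennreal e" if "e > 0" for e
      using *[of "e / pi"] that by simp
    then have "emeasure ?M (?D t) \<le> 0"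
      by (intro ennreal_le_epsilon[where y = 0]) simp
    then show ?thesis
      using False by simp
  qed (simp add: pos)
qed

text \<open>A difference of two concentric disks, the inner one closed, hence the strict bound on
  \<open>s\<close>. The area depends on the squared radii only through \<open>t - s\<close>, which
  is special to dimension two and drives the whole volume computation.\<close>

lemma emeasure_PiM_annulus:
  fixes s t :: real
  assumes "card J = 2" "0 \<le> s"
  shows "emeasure (Pi\<^sub>M J (\<lambda>_. lborel))
           {f \<in> space (Pi\<^sub>M J (\<lambda>_. lborel)). s < (\<Sum>j\<in>J. (f j)\<^sup>2) \<and> (\<Sum>j\<in>J. (f j)\<^sup>2) \<le> t}
         = ennreal (pi * max 0 (t - s))"
proof (cases "s \<le> t")
  case True
  let ?M = "Pi\<^sub>M J (\<lambda>_. lborel :: real measure)"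
  let ?D = "\<lambda>t. {f \<in> space ?M. (\<Sum>j\<in>J. (f j)\<^sup>2) \<le> t}"
  have meas: "?D u \<in> sets ?M" for u
    by measurable
  have "{f \<in> space ?M. s < (\<Sum>j\<in>J. (f j)\<^sup>2) \<and> (\<Sum>j\<in>J. (f j)\<^sup>2) \<le> t} = ?D t - ?D s"
    by auto
  also have "emeasure ?M \<dots> = emeasure ?M (?D t) - emeasure ?M (?D s)"
    using True by (intro emeasure_Diff meas) (auto simp: emeasure_PiM_disk[OF assms(1)])
  also have "\<dots> = ennreal (pi * max 0 (t - s))"
    using True assms(2)
    by (simp add: emeasure_PiM_disk[OF assms(1)] ennreal_minus algebra_simps)
  finally show ?thesis .
next
  case False
  then have "{f \<in> space (Pi\<^sub>M J (\<lambda>_. lborel)). s < (\<Sum>j\<in>J. (f j)\<^sup>2) \<and> (\<Sum>j\<in>J. (f j)\<^sup>2) \<le> t} = {}"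
    by auto
  with False show ?thesis by (simp only:) simp
qed

text \<open>Fubini: fixing the coordinates \<open>x\<close> in \<open>I\<close> leaves an annulus in
  the coordinates \<open>J\<close>, with squared radii \<open>s\<close> and \<open>t\<close> minus
  the sum of squares of \<open>x\<close>.\<close>

lemma emeasure_PiM_ball_minus_cylinder:
  fixes s t :: real
  assumes "finite I" "I \<inter> J = {}" "card J = 2" "0 \<le> s"
  shows "emeasure (Pi\<^sub>M (I \<union> J) (\<lambda>_. lborel))
           {f \<in> space (Pi\<^sub>M (I \<union> J) (\<lambda>_. lborel)). s < (\<Sum>j\<in>J. (f j)\<^sup>2) \<and> (\<Sum>j\<in>I \<union> J. (f j)\<^sup>2) \<le> t}
         = (\<integral>\<^sup>+ x. ennreal (pi * max 0 (t - s - (\<Sum>i\<in>I. (x i)\<^sup>2))) \<partial>Pi\<^sub>M I (\<lambda>_. lborel))"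
    (is "emeasure ?M ?S = _")
proof -
  interpret product_sigma_finite "\<lambda>_. lborel :: real measure"
    by standard
  have J: "finite J"
    using assms by (auto intro: card_ge_0_finite)
  have S: "?S \<in> sets ?M"
    by measurable
  have "emeasure ?M ?S = (\<integral>\<^sup>+ f. indicator ?S f \<partial>?M)"
    using S by simp
  also have "\<dots> = (\<integral>\<^sup>+ x. (\<integral>\<^sup>+ y. indicator ?S (merge I J (x, y)) \<partial>Pi\<^sub>M J (\<lambda>_. lborel)) \<partial>Pi\<^sub>M I (\<lambda>_. lborel))"
    using assms J S by (intro product_nn_integral_fold) auto
  also have "\<dots> = (\<integral>\<^sup>+ x. ennreal (pi * max 0 (t - s - (\<Sum>i\<in>I. (x i)\<^sup>2))) \<partial>Pi\<^sub>M I (\<lambda>_. lborel))"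
  proof (rule nn_integral_cong)
    fix x assume x: "x \<in> space (Pi\<^sub>M I (\<lambda>_. lborel :: real measure))"
    let ?u = "t - (\<Sum>i\<in>I. (x i)\<^sup>2)"
    let ?A = "{f \<in> space (Pi\<^sub>M J (\<lambda>_. lborel)). s < (\<Sum>j\<in>J. (f j)\<^sup>2) \<and> (\<Sum>j\<in>J. (f j)\<^sup>2) \<le> ?u}"
    have "(\<integral>\<^sup>+ y. indicator ?S (merge I J (x, y)) \<partial>Pi\<^sub>M J (\<lambda>_. lborel))
        = (\<integral>\<^sup>+ y. indicator ?A y \<partial>Pi\<^sub>M J (\<lambda>_. lborel))"
    proof (rule nn_integral_cong)
      fix y assume y: "y \<in> space (Pi\<^sub>M J (\<lambda>_. lborel :: real measure))"
      have "(\<Sum>j\<in>J. (merge I J (x, y) j)\<^sup>2) = (\<Sum>j\<in>J. (y j)\<^sup>2)"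
           "(\<Sum>j\<in>I. (merge I J (x, y) j)\<^sup>2) = (\<Sum>j\<in>I. (x j)\<^sup>2)"
        using assms(2) by (auto intro!: sum.cong simp: merge_def)
      moreover have "merge I J (x, y) \<in> space ?M"
        using x y by (auto simp: space_PiM merge_def PiE_def extensional_def)
      ultimately show "(indicator ?S (merge I J (x, y)) :: ennreal) = indicator ?A y"
        using y assms J by (auto simp: indicator_def sum.union_disjoint)
    qed
    also have "\<dots> = emeasure (Pi\<^sub>M J (\<lambda>_. lborel)) ?A"
      by (rule nn_integral_indicator) measurable
    also have "\<dots> = ennreal (pi * max 0 (t - s - (\<Sum>i\<in>I. (x i)\<^sup>2)))"
      by (subst emeasure_PiM_annulus) (use assms in \<open>auto simp: algebra_simps\<close>)
    finally show "(\<integral>\<^sup>+ y. indicator ?S (merge I J (x, y)) \<partial>Pi\<^sub>M J (\<lambda>_. lborel))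
       = ennreal (pi * max 0 (t - s - (\<Sum>i\<in>I. (x i)\<^sup>2)))" .
  qed
  finally show ?thesis .
qed

text \<open>Transfers the product formula through the description of \<open>lborel\<close> as the
  image of a product measure under the coordinate sum. The integral sees \<open>s\<close> and
  \<open>t\<close> only through \<open>t - s\<close>, so different pairs can be compared without
  evaluating it.\<close>

lemma emeasure_ball_minus_cylinder_Basis:
  fixes e1 e2 :: "'a::euclidean_space"
  assumes "e1 \<in> Basis" "e2 \<in> Basis" "e1 \<noteq> e2" "0 \<le> s"
  shows "emeasure lborel {x. s < (e1 \<bullet> x)\<^sup>2 + (e2 \<bullet> x)\<^sup>2 \<and> (norm x)\<^sup>2 \<le> t}
    = (\<integral>\<^sup>+ x. ennreal (pi * max 0 (t - s - (\<Sum>i\<in>Basis - {e1, e2}. (x i)\<^sup>2)))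
         \<partial>Pi\<^sub>M (Basis - {e1, e2}) (\<lambda>_. lborel))"
proof -
  let ?M = "Pi\<^sub>M Basis (\<lambda>_::'a. lborel :: real measure)"
  let ?J = "{e1, e2}"
  let ?I = "Basis - ?J"
  let ?h = "\<lambda>f. \<Sum>b\<in>Basis. f b *\<^sub>R (b :: 'a)"
  let ?S = "{x. s < (e1 \<bullet> x)\<^sup>2 + (e2 \<bullet> x)\<^sup>2 \<and> (norm x)\<^sup>2 \<le> t}"
  have IJ: "?I \<union> ?J = Basis"
    using assms by auto
  have S: "?S \<in> sets borel"
    by measurable
  have "emeasure lborel ?S = emeasure (distr ?M borel ?h) ?S"
    by (subst lborel_eq) simp
  also have "\<dots> = emeasure ?M (?h -` ?S \<inter> space ?M)"
    using S by (intro emeasure_distr) auto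
  also have "?h -` ?S \<inter> space ?M
      = {f \<in> space ?M. s < (\<Sum>j\<in>?J. (f j)\<^sup>2) \<and> (\<Sum>j\<in>Basis. (f j)\<^sup>2) \<le> t}"
  proof -
    have "(norm (?h f))\<^sup>2 = (\<Sum>j\<in>Basis. (f j)\<^sup>2)" for f
      by (subst power2_norm_eq_inner, subst euclidean_inner) (simp add: power2_eq_square)
    moreover have "e1 \<bullet> ?h f = f e1" "e2 \<bullet> ?h f = f e2" for f
      using assms by (simp_all add: inner_commute[of e1] inner_commute[of e2])
    ultimately show ?thesis
      using assms by auto
  qed
  finally show ?thesis
    using emeasure_PiM_ball_minus_cylinder[of ?I ?J s t] assms unfolding IJ by auto
qed

lemma emeasure_cball_minus_cylinder_Basis:
  fixes e1 e2 :: "'a::euclidean_space"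
  assumes "e1 \<in> Basis" "e2 \<in> Basis" "e1 \<noteq> e2" "0 \<le> s" "s \<le> 1"
  shows "emeasure lborel {x \<in> cball 0 1. s < (e1 \<bullet> x)\<^sup>2 + (e2 \<bullet> x)\<^sup>2}
    = emeasure lborel (cball (0::'a) (sqrt (1 - s)))"
proof -
  \<comment> \<open>The comparison with \<open>s = 0\<close> misses the points where both
    coordinates vanish; they lie in a hyperplane.\<close>
  have null: "{x::'a. (e1 \<bullet> x)\<^sup>2 + (e2 \<bullet> x)\<^sup>2 \<le> 0} \<in> null_sets lborel"
  proof -
    have "negligible {x. e1 \<bullet> x = 0}"
      using assms by (intro negligible_hyperplane) auto
    then have "{x::'a. e1 \<bullet> x = 0} \<in> null_sets lborel"
      by (simp add: negligible_iff_null_sets null_sets_completion_iff)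
    then show ?thesis
      by (rule null_sets_subset) (auto simp: sum_power2_le_zero_iff)
  qed
  have "{x \<in> cball 0 1. s < (e1 \<bullet> x)\<^sup>2 + (e2 \<bullet> x)\<^sup>2}
      = {x. s < (e1 \<bullet> x)\<^sup>2 + (e2 \<bullet> x)\<^sup>2 \<and> (norm x)\<^sup>2 \<le> 1}"
    by (auto simp: abs_square_le_1)
  \<comment> \<open>The pairs \<open>(s, 1)\<close> and \<open>(0, 1 - s)\<close> have the same
    difference, hence the same integral.\<close>
  then have "emeasure lborel {x \<in> cball 0 1. s < (e1 \<bullet> x)\<^sup>2 + (e2 \<bullet> x)\<^sup>2}
      = emeasure lborel {x. 0 < (e1 \<bullet> x)\<^sup>2 + (e2 \<bullet> x)\<^sup>2 \<and> (norm x)\<^sup>2 \<le> 1 - s}"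
    using emeasure_ball_minus_cylinder_Basis[of e1 e2 s 1]
      emeasure_ball_minus_cylinder_Basis[of e1 e2 0 "1 - s"] assms by simp
  also have "\<dots> = emeasure lborel (cball (0::'a) (sqrt (1 - s)) - {x. (e1 \<bullet> x)\<^sup>2 + (e2 \<bullet> x)\<^sup>2 \<le> 0})"
    using assms by (intro arg_cong[where f = "emeasure lborel"])
      (auto simp: not_le real_sqrt_le_iff[symmetric, of "(norm _)\<^sup>2"] simp del: real_sqrt_le_iff)
  also have "\<dots> = emeasure lborel (cball (0::'a) (sqrt (1 - s)))"
    using null by (intro emeasure_Diff_null_set) auto
  finally show ?thesis .
qed

section \<open>Invariance of Lebesgue measure under orthogonal maps\<close>

lemma emeasure_lborel_eqI_negligible:
  assumes "A \<in> sets borel" "B \<in> sets borel" "A \<subseteq> B" "negligible (B - A)"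
  shows "emeasure lborel A = emeasure lborel B"
proof -
  have "B - A \<in> null_sets lborel"
    using assms by (auto simp: negligible_iff_null_sets null_sets_completion_iff)
  then have "emeasure lborel (B - (B - A)) = emeasure lborel B"
    using assms by (intro emeasure_Diff_null_set) auto
  moreover have "B - (B - A) = A"
    using assms by auto
  ultimately show ?thesis
    by simp
qed

text \<open>By Vitali's covering theorem, an open set is up to a null set a disjoint union of
  balls, and orthogonal maps preserve balls.\<close>

lemma emeasure_orthogonal_image_open:
  fixes f :: "'a::euclidean_space \<Rightarrow> 'a"
  assumes f: "orthogonal_transformation f" and "open S"
  shows "emeasure lborel (f ` S) = emeasure lborel S"
proof -
  \<comment> \<open>Pairs of centre and radius for all balls inside \<open>S\<close>. They include
    arbitrarily small balls around each point of \<open>S\<close>, as the covering theorem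
    demands.\<close>
  define K where "K = {i. 0 < snd i \<and> ball (fst i) (snd i) \<subseteq> S}"
  let ?B = "\<lambda>i. ball (fst i :: 'a) (snd i)"
  have "\<exists>i. i \<in> K \<and> x \<in> ?B i \<and> snd i < d" if "x \<in> S" "0 < d" for x d
  proof -
    obtain e where e: "e > 0" "ball x e \<subseteq> S"
      using \<open>open S\<close> \<open>x \<in> S\<close> openE by blast
    have "ball x (min e (d / 2)) \<subseteq> S"
      using e by auto
    then show ?thesis
      using e that by (intro exI[of _ "(x, min e (d / 2))"]) (auto simp: K_def)
  qed
  then obtain C where C: "countable C" "C \<subseteq> K"
     "pairwise (\<lambda>i j. disjnt (?B i) (?B j)) C" "negligible (S - (\<Union>i \<in> C. ?B i))"
    using Vitali_covering_theorem_balls[of S K fst snd] by blast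
  define U where "U = (\<Union>i \<in> C. ?B i)"
  have "open U" "U \<subseteq> S"
    using C(2) by (auto simp: U_def K_def)
  have inj: "inj f"
    using f by (rule orthogonal_transformation_inj)
  have lin: "linear f"
    using f by (rule orthogonal_transformation_linear)
  have open_image: "open (f ` T)" if "open T" for T
    using that lin inj by (intro open_surjective_linear_image linear_inj_imp_surj)
  have ball: "f ` ?B i = ball (f (fst i)) (snd i)" for i
    using f by (rule image_orthogonal_transformation_ball)
  have disj: "disjoint_family_on ?B C"
    using C(3) by (auto simp: disjoint_family_on_def pairwise_def disjnt_def)
  have disj': "disjoint_family_on (\<lambda>i. f ` ?B i) C"
    using disj by (auto simp: disjoint_family_on_def image_Int[OF inj, symmetric])
  have "f ` S - f ` U = f ` (S - U)"
    using inj by (simp add: image_set_diff)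
  \<comment> \<open>The part of \<open>S\<close> missed by the balls stays null after mapping, since
    linear maps are differentiable.\<close>
  also have "negligible \<dots>"
    using C(4) lin by (intro negligible_differentiable_image_negligible)
      (auto simp: U_def linear_imp_differentiable_on)
  finally have "emeasure lborel (f ` S) = emeasure lborel (f ` U)"
    using \<open>open S\<close> \<open>open U\<close> \<open>U \<subseteq> S\<close> open_image
    by (intro emeasure_lborel_eqI_negligible[symmetric]) auto
  also have "f ` U = (\<Union>i\<in>C. f ` ?B i)"
    by (auto simp: U_def)
  also have "emeasure lborel \<dots> = (\<integral>\<^sup>+ i. emeasure lborel (f ` ?B i) \<partial>count_space C)"
    using C(1) disj' by (intro emeasure_UN_countable) (auto simp: ball)
  also have "\<dots> = (\<integral>\<^sup>+ i. emeasure lborel (?B i) \<partial>count_space C)"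
    using C(2) by (intro nn_integral_cong) (auto simp: ball K_def emeasure_ball)
  also have "\<dots> = emeasure lborel U"
    unfolding U_def using C(1) disj by (intro emeasure_UN_countable[symmetric]) auto
  also have "\<dots> = emeasure lborel S"
    using \<open>open S\<close> \<open>open U\<close> \<open>U \<subseteq> S\<close> C(4)
    by (intro emeasure_lborel_eqI_negligible) (auto simp: U_def)
  finally show ?thesis .
qed

text \<open>Boxes determine Lebesgue measure. The preimage of an open box is open and, by
  surjectivity, \<open>f\<close> maps it back onto the box, so invariance for images of open sets
  applies.\<close>

lemma distr_lborel_orthogonal_transformation:
  fixes f :: "'a::euclidean_space \<Rightarrow> 'a"
  assumes f: "orthogonal_transformation f"
  shows "distr lborel borel f = lborel"
proof (rule lborel_eqI[symmetric])
  fix l u :: 'a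
  assume lu: "\<And>b. b \<in> Basis \<Longrightarrow> l \<bullet> b \<le> u \<bullet> b"
  have cont: "continuous_on UNIV f"
    using f by (intro linear_continuous_on linear_linear[THEN iffD2] orthogonal_transformation_linear)
  then have [measurable]: "f \<in> borel_measurable borel"
    by (rule borel_measurable_continuous_onI)
  have "emeasure (distr lborel borel f) (box l u) = emeasure lborel (f -` box l u)"
    by (simp add: emeasure_distr)
  also have "\<dots> = emeasure lborel (f ` (f -` box l u))"
    using f cont by (intro emeasure_orthogonal_image_open[symmetric] open_vimage) auto
  also have "f ` (f -` box l u) = box l u"
    using f by (intro surj_image_vimage_eq orthogonal_transformation_surj)
  finally show "emeasure (distr lborel borel f) (box l u) = (\<Prod>b\<in>Basis. (u - l) \<bullet> b)"
    using lu by simp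
qed simp

section \<open>Volume outside a cylinder for an arbitrary orthonormal pair\<close>

lemma measure_cball_minus_cylinder:
  fixes c1 c2 :: "'a::euclidean_space"
  assumes "norm c1 = 1" "norm c2 = 1" "c1 \<bullet> c2 = 0" "0 \<le> s" "s \<le> 1"
  shows "measure lborel {x \<in> cball 0 1. s < (c1 \<bullet> x)\<^sup>2 + (c2 \<bullet> x)\<^sup>2}
    = sqrt (1 - s) ^ DIM('a) * measure lborel (cball (0::'a) 1)"
proof -
  \<comment> \<open>The orthonormal pair forces dimension at least two, so two distinct basis
    vectors exist as targets of the rotation.\<close>
  have "pairwise orthogonal {c1, c2}" "0 \<notin> {c1, c2}"
    using assms by (auto simp: pairwise_insert orthogonal_def inner_commute)
  then have "independent {c1, c2}"
    by (rule pairwise_orthogonal_independent)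
  then have "card {c1, c2} \<le> DIM('a)"
    by (simp add: independent_bound)
  moreover have "c1 \<noteq> c2"
    using assms by (auto simp: norm_eq_1)
  ultimately obtain e1 e2 :: 'a where e: "e1 \<in> Basis" "e2 \<in> Basis" "e1 \<noteq> e2"
    using card_le_Suc0_iff_eq[of "Basis :: 'a set"] by auto
  let ?S = "\<lambda>a b. {x \<in> cball 0 1 :: 'a set. s < (a \<bullet> x)\<^sup>2 + (b \<bullet> x)\<^sup>2}"
  obtain f where f: "orthogonal_transformation f" "f c1 = e1" "f c2 = e2"
    using orthogonal_transformation_exists_pair[of c1 e1 c2 e2] assms e
    by (auto simp: inner_not_same_Basis)
  have "linear f"
    using f by (auto simp: orthogonal_transformation_def)
  then have [measurable]: "f \<in> borel_measurable borel"
    by (intro borel_measurable_continuous_onI linear_continuous_on linear_linear[THEN iffD2])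
  have "?S e1 e2 \<in> sets borel"
    by measurable
  then have "emeasure (distr lborel borel f) (?S e1 e2) = emeasure lborel (f -` ?S e1 e2)"
    by (simp add: emeasure_distr)
  also have "f -` ?S e1 e2 = ?S c1 c2"
    using f by (auto simp: orthogonal_transformation_norm orthogonal_transformation_def)
  finally have "measure lborel (?S c1 c2) = measure lborel (?S e1 e2)"
    by (simp add: measure_def distr_lborel_orthogonal_transformation[OF f(1)])
  also have "\<dots> = measure lborel (cball (0::'a) (sqrt (1 - s)))"
    using emeasure_cball_minus_cylinder_Basis[OF e assms(4,5)] by (simp add: measure_def)
  also have "\<dots> = sqrt (1 - s) ^ DIM('a) * measure lborel (cball (0::'a) 1)"
    using assms by (simp add: content_cball)
  finally show ?thesis .
qed

text \<open>The closed condition is squeezed: it implies the strict one for every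
  \<open>u < s\<close>, and the volume formula is continuous as \<open>u\<close> tends to
  \<open>s\<close> from the left. The assumption \<open>0 < s\<close> leaves room for nonnegative
  \<open>u\<close> there.\<close>

lemma measure_cball_minus_open_cylinder:
  fixes c1 c2 :: "'a::euclidean_space"
  assumes "norm c1 = 1" "norm c2 = 1" "c1 \<bullet> c2 = 0" "0 < s" "s \<le> 1"
  shows "measure lborel {x \<in> cball 0 1. s \<le> (c1 \<bullet> x)\<^sup>2 + (c2 \<bullet> x)\<^sup>2}
    = sqrt (1 - s) ^ DIM('a) * measure lborel (cball (0::'a) 1)"
    (is "measure lborel ?E = ?v s")
proof (rule antisym)
  let ?S = "\<lambda>u. {x \<in> cball 0 1 :: 'a set. u < (c1 \<bullet> x)\<^sup>2 + (c2 \<bullet> x)\<^sup>2}"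
  have fin: "A \<in> fmeasurable lborel" if "A \<subseteq> cball 0 1" "A \<in> sets borel" for A :: "'a set"
  proof (rule fmeasurableI2)
    show "cball (0::'a) 1 \<in> fmeasurable lborel"
      using emeasure_lborel_cball_finite[of "0::'a" 1] by (simp add: fmeasurable_def)
  qed (use that in auto)
  have S: "?S u \<in> fmeasurable lborel" for u
    by (intro fin) auto
  have E: "?E \<in> fmeasurable lborel"
    by (intro fin) auto
  have "measure lborel (?S s) \<le> measure lborel ?E"
    using S E by (intro measure_mono_fmeasurable) auto
  then show "?v s \<le> measure lborel ?E"
    using measure_cball_minus_cylinder[OF assms(1-3), of s] assms by simp
  have "eventually (\<lambda>u. u \<in> {0<..<s}) (at_left s)"
    using assms by (intro eventually_at_leftI[of 0]) auto
  then have "eventually (\<lambda>u. measure lborel ?E \<le> ?v u) (at_left s)"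
  proof eventually_elim
    case (elim u)
    have "measure lborel ?E \<le> measure lborel (?S u)"
      using elim S E by (intro measure_mono_fmeasurable) auto
    then show ?case
      using measure_cball_minus_cylinder[OF assms(1-3), of u] elim assms by simp
  qed
  moreover have "(?v \<longlongrightarrow> ?v s) (at_left s)"
    by (intro tendsto_intros)
  ultimately show "measure lborel ?E \<le> ?v s"
    by (intro tendsto_lowerbound) auto
qed

section \<open>The planar map, its image, and distance to the circle\<close>

lemma power2_norm_vec_2: "(norm (v :: real^2))\<^sup>2 = (v $ 1)\<^sup>2 + (v $ 2)\<^sup>2"
  unfolding power2_norm_eq_inner by (simp add: inner_vec_def sum_2 power2_eq_square)

lemma norm_planar_map: "(norm (planar_map c1 c2 x))\<^sup>2 = (c1 \<bullet> x)\<^sup>2 + (c2 \<bullet> x)\<^sup>2"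
  by (simp add: planar_map_def power2_norm_vec_2)

lemma continuous_on_planar_map: "continuous_on A (planar_map c1 c2)"
proof -
  have "planar_map c1 c2 = (\<lambda>x. \<chi> i. (if i = 1 then c1 else c2) \<bullet> x)"
    by (auto simp: planar_map_def vec_eq_iff forall_2)
  then show ?thesis
    by (simp only:) (intro continuous_intros)
qed

lemma planar_map_image_cball:
  assumes "norm c1 = 1" "norm c2 = 1" "c1 \<bullet> c2 = 0"
  shows "planar_map c1 c2 ` cball 0 1 = cball 0 1"
proof
  have c: "c1 \<bullet> c1 = 1" "c2 \<bullet> c2 = 1" "c1 \<bullet> c2 = 0" "c2 \<bullet> c1 = 0"
    using assms by (auto simp: norm_eq_1 inner_commute)
  have norm_comb: "(norm (u *\<^sub>R c1 + v *\<^sub>R c2))\<^sup>2 = u\<^sup>2 + v\<^sup>2" for u v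
    by (simp only: power2_norm_eq_inner inner_add_left inner_add_right inner_scaleR_left
        inner_scaleR_right c) (simp add: power2_eq_square)
  show "planar_map c1 c2 ` cball 0 1 \<subseteq> cball 0 1"
  proof clarsimp
    fix x :: "real^'a" assume x: "norm x \<le> 1"
    \<comment> \<open>The orthogonal projection of \<open>x\<close> onto the span of
      \<open>c1\<close> and \<open>c2\<close>; it has the norm of the image of \<open>x\<close>.
      Bessel's inequality follows from Cauchy-Schwarz applied to
      \<open>y \<bullet> x\<close>.\<close>
    define y where "y = (c1 \<bullet> x) *\<^sub>R c1 + (c2 \<bullet> x) *\<^sub>R c2"
    have y: "(norm y)\<^sup>2 = (norm (planar_map c1 c2 x))\<^sup>2"
      by (simp add: y_def norm_comb norm_planar_map)
    also have "\<dots> = y \<bullet> x"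
      unfolding norm_planar_map by (simp add: y_def inner_add_left power2_eq_square)
    also have "\<dots> \<le> norm y * norm x"
      by (rule norm_cauchy_schwarz)
    also have "\<dots> \<le> norm y * 1"
      using x by (intro mult_left_mono) auto
    finally have "norm y \<le> 1"
      by (cases "norm y = 0") (auto simp: power2_eq_square)
    moreover have "norm (planar_map c1 c2 x) = norm y"
      using y by simp
    ultimately show "norm (planar_map c1 c2 x) \<le> 1"
      by simp
  qed
  show "cball 0 1 \<subseteq> planar_map c1 c2 ` cball 0 1"
  proof
    fix y :: "real^2" assume y: "y \<in> cball 0 1"
    define x where "x = (y $ 1) *\<^sub>R c1 + (y $ 2) *\<^sub>R c2"
    have "planar_map c1 c2 x = y"
      by (simp add: x_def planar_map_def inner_add_right c vec_eq_iff forall_2)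
    moreover have "(norm x)\<^sup>2 = (norm y)\<^sup>2"
      by (simp add: x_def norm_comb power2_norm_vec_2)
    then have "norm x = norm y"
      by simp
    ultimately show "y \<in> planar_map c1 c2 ` cball 0 1"
      using y by (intro image_eqI[of _ _ x]) auto
  qed
qed

text \<open>The radial projection of \<open>y\<close> attains the distance, and the reverse triangle
  inequality shows that no point of the sphere is nearer.\<close>

lemma infdist_sphere_0:
  fixes y :: "'a::euclidean_space"
  assumes "0 \<le> r"
  shows "infdist y (sphere 0 r) = \<bar>norm y - r\<bar>"
proof (rule antisym)
  obtain b :: 'a where b: "b \<in> Basis"
    using nonempty_Basis by blast
  \<comment> \<open>At the centre every direction is equally good, so a basis vector serves.\<close>
  define u where "u = (if y = 0 then b else y /\<^sub>R norm y)"
  have u: "norm u = 1" "y = norm y *\<^sub>R u"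
    using b by (auto simp: u_def)
  have "dist y (r *\<^sub>R u) = norm ((norm y - r) *\<^sub>R u)"
    by (subst u(2)) (simp add: dist_norm scaleR_diff_left)
  then show "infdist y (sphere 0 r) \<le> \<bar>norm y - r\<bar>"
    using u assms by (intro infdist_le2[of "r *\<^sub>R u"]) auto
  have "sphere 0 r \<noteq> ({} :: 'a set)"
    using assms by simp
  moreover have "\<bar>norm y - r\<bar> \<le> dist y z" if "z \<in> sphere 0 r" for z
    using that norm_triangle_ineq3[of y z] by (simp add: dist_norm)
  ultimately show "\<bar>norm y - r\<bar> \<le> infdist y (sphere 0 r)"
    unfolding infdist_def by (auto intro!: cINF_greatest)
qed

text \<open>The frontier of the image is the unit circle. The absolute value stays because
  \<open>x\<close> may lie outside the ball.\<close>

lemma mapped_close_to_boundary_planar_map_iff: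
  assumes "norm c1 = 1" "norm c2 = 1" "c1 \<bullet> c2 = 0"
  shows "mapped_close_to_boundary (planar_map c1 c2) (cball 0 1) \<delta> x
    \<longleftrightarrow> \<bar>norm (planar_map c1 c2 x) - 1\<bar> \<le> \<delta>"
  by (simp add: mapped_close_to_boundary_def planar_map_image_cball[OF assms] infdist_sphere_0)

section \<open>Probability that one sample is mapped close to the boundary\<close>

lemma measure_mapped_close_to_boundary:
  fixes \<xi> :: "'w \<Rightarrow> real ^ 'n"
  assumes "uniformly_distributed_over M \<xi> (cball 0 1)"
    and "norm c1 = 1" "norm c2 = 1" "c1 \<bullet> c2 = 0" "0 < \<delta>" "\<delta> < 1"
  shows "measure (distr M borel \<xi>)
      {x. mapped_close_to_boundary (planar_map c1 c2) (cball 0 1) \<delta> x}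
    = (2 * \<delta> - \<delta>\<^sup>2) powr (real CARD('n) / 2)"
proof -
  let ?Q = "cball 0 1 :: (real^'n) set"
  let ?E = "{x. mapped_close_to_boundary (planar_map c1 c2) ?Q \<delta> x}"
  have E: "?E \<in> sets borel"
    unfolding mapped_close_to_boundary_planar_map_iff[OF assms(2-4)]
    using continuous_on_planar_map[of UNIV c1 c2]
    by (intro borel_closed closed_Collect_le continuous_intros)
  have Q: "measure lborel ?Q > 0"
    by (simp add: content_cball_pos)
  \<comment> \<open>Inside the ball the image has norm at most 1, so only the lower bound
    \<open>1 - \<delta>\<close> matters; squaring it gives the cylinder parameter.\<close>
  have "?Q \<inter> ?E = {x \<in> ?Q. (1 - \<delta>)\<^sup>2 \<le> (c1 \<bullet> x)\<^sup>2 + (c2 \<bullet> x)\<^sup>2}"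
  proof -
    have "norm (planar_map c1 c2 x) \<le> 1" if "x \<in> ?Q" for x
      using planar_map_image_cball[OF assms(2-4)] that by (metis image_eqI mem_cball_0)
    moreover have "1 - \<delta> \<le> norm (planar_map c1 c2 x) \<longleftrightarrow> (1 - \<delta>)\<^sup>2 \<le> (c1 \<bullet> x)\<^sup>2 + (c2 \<bullet> x)\<^sup>2" for x
      unfolding norm_planar_map[symmetric] using assms(6) by simp
    ultimately show ?thesis
      using assms(5) unfolding mapped_close_to_boundary_planar_map_iff[OF assms(2-4)] set_eq_iff
      by (smt (verit, best) Int_iff mem_Collect_eq)
  qed
  then have "measure lborel (?Q \<inter> ?E) = sqrt (1 - (1 - \<delta>)\<^sup>2) ^ CARD('n) * measure lborel ?Q"
    using measure_cball_minus_open_cylinder[OF assms(2-4), of "(1 - \<delta>)\<^sup>2"] assms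
    by (simp add: power_le_one)
  moreover have "sqrt (1 - (1 - \<delta>)\<^sup>2) ^ CARD('n) = (2 * \<delta> - \<delta>\<^sup>2) powr (real CARD('n) / 2)"
  proof -
    have "0 < \<delta> * (2 - \<delta>)"
      using assms by simp
    then have pos: "0 < 2 * \<delta> - \<delta>\<^sup>2"
      by (simp add: algebra_simps power2_eq_square)
    have "sqrt (1 - (1 - \<delta>)\<^sup>2) = (2 * \<delta> - \<delta>\<^sup>2) powr (1 / 2)"
      using pos by (simp add: powr_half_sqrt power2_diff)
    then show ?thesis
      using pos by (simp add: powr_realpow[symmetric] powr_powr)
  qed
  moreover have "distr M borel \<xi> = uniform_measure lborel ?Q"
    using assms(1) by (simp add: uniformly_distributed_over_def)
  moreover have "measure (uniform_measure lborel ?Q) ?E = measure lborel (?Q \<inter> ?E) / measure lborel ?Q"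
    using E Q by (intro measure_uniform_measure)
      (auto simp: emeasure_lborel_cball_finite measure_def less_top[symmetric] zero_less_iff_neq_zero)
  ultimately show ?thesis
    using Q by simp
qed

section \<open>Independent samples and the threshold for their number\<close>

text \<open>The complementary event is that all samples miss \<open>A\<close>; independence makes
  its probability a product of \<open>N\<close> equal factors.\<close>

lemma (in prob_space) prob_exists_independent_copy:
  assumes "independent_copies M \<xi> X" "A \<in> sets borel" "N \<ge> 1"
  shows "prob {\<omega> \<in> space M. \<exists>i\<in>{1..N}. X i \<omega> \<in> A} = 1 - (1 - measure (distr M borel \<xi>) A) ^ N"
proof -
  have indep: "indep_vars (\<lambda>_. borel) X {1..N}"
    using assms by (simp add: independent_copies_def)
  have X [measurable]: "X i \<in> borel_measurable M" if "i \<in> {1..N}" for i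
    using indep that by (auto simp: indep_vars_def2)
  have hit: "X i -` A \<inter> space M \<in> events" if "i \<in> {1..N}" for i
    using X[OF that] assms(2) by (rule measurable_sets)
  have "prob (X i -` (- A) \<inter> space M) = 1 - measure (distr M borel \<xi>) A" if "i \<in> {1..N}" for i
  proof -
    have "X i -` (- A) \<inter> space M = space M - (X i -` A \<inter> space M)"
      by auto
    then have "prob (X i -` (- A) \<inter> space M) = 1 - prob (X i -` A \<inter> space M)"
      using hit[OF that] by (simp add: prob_compl)
    also have "prob (X i -` A \<inter> space M) = measure (distr M borel (X i)) A"
      using X[OF that] assms(2) by (simp add: measure_distr)
    also have "distr M borel (X i) = distr M borel \<xi>"
      using assms that by (auto simp: independent_copies_def)
    finally show ?thesis .
  qed
  then have "prob (\<Inter>i\<in>{1..N}. X i -` (- A) \<inter> space M) = (1 - measure (distr M borel \<xi>) A) ^ N"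
    using indep_varsD_finite[OF indep, of "\<lambda>_. - A"] assms by auto
  moreover have "{\<omega> \<in> space M. \<exists>i\<in>{1..N}. X i \<omega> \<in> A}
      = space M - (\<Inter>i\<in>{1..N}. X i -` (- A) \<inter> space M)"
    using assms(3) by auto
  moreover have "(\<Inter>i\<in>{1..N}. X i -` (- A) \<inter> space M) \<in> events"
    using assms(2,3) by (intro sets.finite_INT measurable_sets[OF X]) auto
  ultimately show ?thesis
    by (simp add: prob_compl)
qed

text \<open>Taking logarithms of \<open>(1 - a) ^ N \<le> 1 - p\<close> and dividing by
  \<open>ln (1 - a)\<close>, which is negative, reverses the inequality into a lower bound on
  \<open>N\<close>.\<close>

lemma one_minus_power_ge_iff:
  fixes a p :: real
  assumes "0 < a" "a < 1" "0 < p" "p < 1"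
  shows "p \<le> 1 - (1 - a) ^ N \<longleftrightarrow> \<lceil>ln (1 - p) / ln (1 - a)\<rceil> \<le> int N"
proof -
  have neg: "ln (1 - a) < 0"
    using assms by simp
  have "p \<le> 1 - (1 - a) ^ N \<longleftrightarrow> ln ((1 - a) ^ N) \<le> ln (1 - p)"
    using assms by (subst ln_le_cancel_iff) auto
  also have "\<dots> \<longleftrightarrow> ln (1 - p) / ln (1 - a) \<le> real N"
    using neg assms by (simp add: ln_realpow divide_le_eq)
  also have "\<dots> \<longleftrightarrow> \<lceil>ln (1 - p) / ln (1 - a)\<rceil> \<le> int N"
    by (simp add: ceiling_le_iff)
  finally show ?thesis .
qed

text \<open>Rounding up adds at most 1, which vanishes relative to \<open>- (L / a)\<close>, and
  \<open>ln (1 - a)\<close> behaves like \<open>- a\<close> near 0. Both bounds of the sandwich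
  therefore have ratio tending to 1.\<close>

lemma ceiling_div_ln_asymp:
  fixes L :: real
  assumes "L < 0"
  shows "((\<lambda>a. real_of_int \<lceil>L / ln (1 - a)\<rceil> / (- (L / a))) \<longlongrightarrow> 1) (at_right 0)"
proof (rule tendsto_sandwich)
  show "((\<lambda>a. (L / ln (1 - a)) / (- (L / a))) \<longlongrightarrow> 1) (at_right 0)"
    using assms by real_asymp
  show "((\<lambda>a. (L / ln (1 - a) + 1) / (- (L / a))) \<longlongrightarrow> 1) (at_right 0)"
    using assms by real_asymp
  have pos: "eventually (\<lambda>a. 0 \<le> - (L / a)) (at_right 0)"
    using assms by (intro eventually_at_rightI[of 0 1]) (auto simp: divide_le_0_iff)
  then show "eventually (\<lambda>a. (L / ln (1 - a)) / (- (L / a))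
      \<le> real_of_int \<lceil>L / ln (1 - a)\<rceil> / (- (L / a))) (at_right 0)"
    by eventually_elim (intro divide_right_mono le_of_int_ceiling)
  from pos show "eventually (\<lambda>a. real_of_int \<lceil>L / ln (1 - a)\<rceil> / (- (L / a))
      \<le> (L / ln (1 - a) + 1) / (- (L / a))) (at_right 0)"
    by eventually_elim (intro divide_right_mono of_int_ceiling_le_add_one)
qed

section \<open>The minimal sample size and its asymptotics\<close>

text \<open>Existence of a sufficient size is part of the conclusion because \<open>LEAST\<close>
  says nothing useful about a predicate that never holds.\<close>

theorem theorem2:
  fixes M :: "'w measure"
    and \<xi> :: "'w \<Rightarrow> real ^ 'n"
    and X :: "nat \<Rightarrow> 'w \<Rightarrow> real ^ 'n"
    and c1 c2 :: "real ^ 'n"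
    and Q :: "(real ^ 'n) set"
    and g :: "real ^ 'n \<Rightarrow> real ^ 2"
    and n :: nat
    and p :: real
  assumes "n = CARD('n)" and "n \<ge> 3"
    and "Q = cball 0 1"
    and "prob_space M"
    and "uniformly_distributed_over M \<xi> Q"
    and "independent_copies M \<xi> X"
    and "norm c1 = 1" and "norm c2 = 1" and "c1 \<bullet> c2 = 0"
    and "g = planar_map c1 c2"
    and "0 < p" and "p < 1"
  shows "(\<forall>\<delta>. 0 < \<delta> \<and> \<delta> < 1 \<longrightarrow>
            (\<exists>N. sufficient_sample_size M X g Q p \<delta> N) \<and>
            int (N_min M X g Q p \<delta>) =
              \<lceil>ln (1 - p) / ln (1 - (2 * \<delta> - \<delta>\<^sup>2) powr (real n / 2))\<rceil>)
       \<and> ((\<lambda>\<delta>. real (N_min M X g Q p \<delta>) /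
                (- (ln (1 - p) / (2 * \<delta> - \<delta>\<^sup>2) powr (real n / 2)))) \<longlongrightarrow> 1) (at_right 0)"
proof -
  interpret prob_space M
    by fact
  define a where "a \<delta> = (2 * \<delta> - \<delta>\<^sup>2) powr (real n / 2)" for \<delta> :: real
  define k where "k \<delta> = \<lceil>ln (1 - p) / ln (1 - a \<delta>)\<rceil>" for \<delta>
  have main: "(\<exists>N. sufficient_sample_size M X g Q p \<delta> N) \<and> int (N_min M X g Q p \<delta>) = k \<delta>"
    if \<delta>: "0 < \<delta>" "\<delta> < 1" for \<delta>
  proof -
    have "0 < \<delta> * (2 - \<delta>)" "0 < (1 - \<delta>)\<^sup>2"
      using \<delta> by simp_all
    then have "0 < 2 * \<delta> - \<delta>\<^sup>2" "2 * \<delta> - \<delta>\<^sup>2 < 1"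
      by (simp_all add: algebra_simps power2_eq_square)
    then have a: "0 < a \<delta>" "a \<delta> < 1"
      using assms(2) powr_less_mono2[of "real n / 2" "2 * \<delta> - \<delta>\<^sup>2" 1] by (simp_all add: a_def)
    \<comment> \<open>Both logarithms are negative, so the quotient is positive. Hence
      \<open>nat\<close> loses nothing, and the demand \<open>N \<ge> 1\<close> is met by the
      threshold itself.\<close>
    then have k: "k \<delta> \<ge> 1"
      using assms by (simp add: k_def one_le_ceiling zero_less_divide_iff)
    let ?A = "{x. mapped_close_to_boundary g Q \<delta> x}"
    have A: "?A \<in> sets borel"
      unfolding assms(3,10) mapped_close_to_boundary_planar_map_iff[OF assms(7-9)]
      using continuous_on_planar_map[of UNIV c1 c2]
      by (intro borel_closed closed_Collect_le continuous_intros)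
    have "measure (distr M borel \<xi>) ?A = a \<delta>"
      using measure_mapped_close_to_boundary[of M \<xi> c1 c2 \<delta>] assms \<delta> by (simp add: a_def)
    then have prob: "prob {\<omega> \<in> space M. \<exists>i\<in>{1..N}. mapped_close_to_boundary g Q \<delta> (X i \<omega>)}
        = 1 - (1 - a \<delta>) ^ N" if "N \<ge> 1" for N
      using prob_exists_independent_copy[OF assms(6) A that] by simp
    \<comment> \<open>The sufficient sizes are exactly those from \<open>k \<delta>\<close> upwards;
      at \<open>N = 0\<close> both sides are false.\<close>
    have suff: "sufficient_sample_size M X g Q p \<delta> N \<longleftrightarrow> nat (k \<delta>) \<le> N" for N
    proof (cases "N \<ge> 1")
      case True
      have "sufficient_sample_size M X g Q p \<delta> N \<longleftrightarrow> p \<le> 1 - (1 - a \<delta>) ^ N"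
        unfolding sufficient_sample_size_def prob[OF True] using True by blast
      also have "\<dots> \<longleftrightarrow> k \<delta> \<le> int N"
        unfolding k_def by (rule one_minus_power_ge_iff[OF a assms(11,12)])
      finally show ?thesis
        by (simp add: nat_le_iff)
    next
      case False
      then show ?thesis
        using k by (simp add: sufficient_sample_size_def)
    qed
    then have "N_min M X g Q p \<delta> = nat (k \<delta>)"
      by (auto simp: N_min_def intro!: Least_equality)
    then show ?thesis
      using k suff by auto
  qed
  \<comment> \<open>As \<open>\<delta>\<close> tends to 0 from the right, so does
    \<open>a \<delta>\<close>; the asymptotics in the variable \<open>a\<close> can be composed with
    it.\<close>
  have "filterlim a (at_right 0) (at_right 0)"
    unfolding a_def using assms(2) by real_asymp
  then have "((\<lambda>\<delta>. real_of_int (k \<delta>) / (- (ln (1 - p) / a \<delta>))) \<longlongrightarrow> 1) (at_right 0)"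
    unfolding k_def using assms(11,12)
    by (intro filterlim_compose[OF ceiling_div_ln_asymp]) auto
  \<comment> \<open>The exact formula holds only for \<open>\<delta>\<close> between 0 and 1, which
    is enough for a limit at 0.\<close>
  moreover have "eventually (\<lambda>\<delta>. real_of_int (k \<delta>) / (- (ln (1 - p) / a \<delta>))
      = real (N_min M X g Q p \<delta>) / (- (ln (1 - p) / a \<delta>))) (at_right 0)"
  proof (rule eventually_at_rightI[of 0 1])
    fix \<delta> :: real assume "\<delta> \<in> {0<..<1}"
    then have "int (N_min M X g Q p \<delta>) = k \<delta>"
      using main by simp
    then have "real (N_min M X g Q p \<delta>) = real_of_int (k \<delta>)"
      by linarith
    then show "real_of_int (k \<delta>) / (- (ln (1 - p) / a \<delta>))
        = real (N_min M X g Q p \<delta>) / (- (ln (1 - p) / a \<delta>))"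
      by (simp only:)
  qed simp
  ultimately have lim: "((\<lambda>\<delta>. real (N_min M X g Q p \<delta>) / (- (ln (1 - p) / a \<delta>))) \<longlongrightarrow> 1) (at_right 0)"
    by (rule Lim_transform_eventually)
  show ?thesis
  proof (intro conjI allI impI)
    fix \<delta> :: real assume "0 < \<delta> \<and> \<delta> < 1"
    then show "\<exists>N. sufficient_sample_size M X g Q p \<delta> N"
      and "int (N_min M X g Q p \<delta>)
        = \<lceil>ln (1 - p) / ln (1 - (2 * \<delta> - \<delta>\<^sup>2) powr (real n / 2))\<rceil>"
      using main[of \<delta>] by (simp_all add: k_def a_def)
  next
    show "((\<lambda>\<delta>. real (N_min M X g Q p \<delta>)
        / (- (ln (1 - p) / (2 * \<delta> - \<delta>\<^sup>2) powr (real n / 2)))) \<longlongrightarrow> 1) (at_right 0)"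
      using lim by (simp only: a_def)
  qed
qed

end
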